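(* Let $A$ be a dual ring. The map $\operatorname{Ann}\colon \operatorname{CoSp}(A)\to \operatorname{Spec}(A)$, $C\mapsto \operatorname{Ann}(C)$, is a bijection, with inverse given by $P\mapsto \operatorname{Ann}(P)$.
   Context: All rings are commutative with identity. For ideals $I,J$ of a ring $A$, $\operatorname{Ann}(I)=\{a\in A\mid aI=0\}$ and $(J:I)=\{a\in A\mid aI\subseteq J\}$. A ring $A$ is a dual ring if $\operatorname{Ann}(\operatorname{Ann}(I))=I$ for every ideal $I$ of $A$. The coproduct of $I$ and $J$ is the ideal $[I:J]:=(J:\operatorname{Ann}(I))=\{a\in A\mid a\operatorname{Ann}(I)\subseteq J\}$. An ideal $C$ of $A$ is coprime if $C\neq 0$ and, for all ideals $I,J$ of $A$, $C\subseteq [I:J]$ implies $C\subseteq I$ or $C\subseteq J$. $\operatorname{CoSp}(A)$ is the set of coprime ideals of $A$, and $\operatorname{Spec}(A)$ is the set of prime ideals of $A$. *)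

theory Defs
  imports "HOL-Algebra.Ideal"
begin

definition annihilator :: "('a, 'b) ring_scheme \<Rightarrow> 'a set \<Rightarrow> 'a set" where
  "annihilator A I = {a \<in> carrier A. \<forall>x\<in>I. a \<otimes>\<^bsub>A\<^esub> x = \<zero>\<^bsub>A\<^esub>}"

text \<open>\<open>ideal_quotient A J I\<close> is \<open>(J : I)\<close>.\<close>

definition ideal_quotient :: "('a, 'b) ring_scheme \<Rightarrow> 'a set \<Rightarrow> 'a set \<Rightarrow> 'a set" where
  "ideal_quotient A J I = {a \<in> carrier A. \<forall>x\<in>I. a \<otimes>\<^bsub>A\<^esub> x \<in> J}"

text \<open>\<open>coproduct A I J\<close> is \<open>[I : J]\<close>; the roles of \<open>I\<close> and \<open>J\<close> are swapped on the right-hand side.\<close>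

definition coproduct :: "('a, 'b) ring_scheme \<Rightarrow> 'a set \<Rightarrow> 'a set \<Rightarrow> 'a set" where
  "coproduct A I J = ideal_quotient A J (annihilator A I)"

definition coprime_ideal :: "('a, 'b) ring_scheme \<Rightarrow> 'a set \<Rightarrow> bool" where
  "coprime_ideal A C \<longleftrightarrow> ideal C A \<and> C \<noteq> {\<zero>\<^bsub>A\<^esub>} \<and>
     (\<forall>I J. ideal I A \<longrightarrow> ideal J A \<longrightarrow> C \<subseteq> coproduct A I J \<longrightarrow> C \<subseteq> I \<or> C \<subseteq> J)"

definition CoSp :: "('a, 'b) ring_scheme \<Rightarrow> 'a set set" where
  "CoSp A = {C. coprime_ideal A C}"

definition Spec :: "('a, 'b) ring_scheme \<Rightarrow> 'a set set" where
  "Spec A = {P. primeideal P A}"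

locale dual_ring = cring A for A (structure) +
  assumes annihilator_annihilator: "ideal I A \<Longrightarrow> annihilator A (annihilator A I) = I"

end

theory Submission
  imports Defs
begin

text \<open>Every ideal of a dual ring is an annihilator, so \<open>C \<subseteq> [I : J]\<close> is equivalent to
  \<open>Ann(I) Ann(J) \<subseteq> Ann(C)\<close>, while \<open>C \<subseteq> I\<close> is equivalent to \<open>Ann(I) \<subseteq> Ann(C)\<close>. Coprimality of
  \<open>C\<close> thus says that \<open>Ann(C)\<close> is prime with respect to products of ideals.\<close>

lemma annihilator_antimono: "I \<subseteq> J \<Longrightarrow> annihilator A J \<subseteq> annihilator A I"
  by (auto simp: annihilator_def)

lemma (in cring) ideal_annihilator:
  assumes "I \<subseteq> carrier R"
  shows "ideal (annihilator R I) R"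
proof (rule idealI)
  show "ring R" by (rule ring_axioms)
  \<comment> \<open>\<open>a_inv_def[symmetric]\<close> turns the inverse of
    \<open>add_monoid R\<close> back into ring negation, so that \<open>l_minus\<close>
    applies.\<close>
  show "subgroup (annihilator R I) (add_monoid R)"
    using assms
    by unfold_locales
      (auto simp: annihilator_def subset_iff l_distr l_minus a_inv_def[symmetric])
next
  fix a x assume a: "a \<in> annihilator R I" and x: "x \<in> carrier R"
  then show xa: "x \<otimes> a \<in> annihilator R I"
    using assms by (auto simp: annihilator_def subset_iff m_assoc)
  show "a \<otimes> x \<in> annihilator R I"
    using a x xa by (simp add: annihilator_def m_comm)
qed

text \<open>Links the two nontriviality conditions: a coprime ideal is nonzero, a prime ideal is
  proper.\<close>

lemma (in cring) one_in_annihilator_iff: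
  assumes "ideal I R"
  shows "\<one> \<in> annihilator R I \<longleftrightarrow> I = {\<zero>}"
proof -
  interpret I: ideal I R by fact
  have "\<one> \<in> annihilator R I \<longleftrightarrow> I \<subseteq> {\<zero>}"
    using I.Icarr by (auto simp: annihilator_def)
  then show ?thesis
    using I.zero_closed by blast
qed

context dual_ring
begin

text \<open>Taking annihilators reverses inclusions; doing it twice gives the converse, by
  duality.\<close>

lemma subset_iff_annihilator:
  assumes "ideal I A" "ideal J A"
  shows "I \<subseteq> J \<longleftrightarrow> annihilator A J \<subseteq> annihilator A I"
  using annihilator_antimono[of _ _ A] annihilator_annihilator assms by metis

text \<open>Since \<open>J\<close> is the annihilator of \<open>annihilator A J\<close>, the
  condition \<open>c \<otimes> i \<in> J\<close> says that every
  \<open>c \<otimes> i \<otimes> j\<close> vanishes; commutativity then moves \<open>c\<close> to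
  the end.\<close>

lemma subset_coproduct_iff:
  assumes C: "ideal C A" and J: "ideal J A"
  shows "C \<subseteq> coproduct A I J \<longleftrightarrow>
    (\<forall>i \<in> annihilator A I. \<forall>j \<in> annihilator A J. i \<otimes> j \<in> annihilator A C)"
proof -
  have Cc: "c \<in> carrier A" if "c \<in> C" for c
    using that ideal.Icarr[OF C] by blast
  have ann: "x \<in> carrier A" if "x \<in> annihilator A K" for x K
    using that by (simp add: annihilator_def)
  have mem_J: "x \<in> J \<longleftrightarrow> (\<forall>j \<in> annihilator A J. x \<otimes> j = \<zero>)" if "x \<in> carrier A" for x
    using annihilator_annihilator[OF J] that by (auto simp: annihilator_def)
  have "C \<subseteq> coproduct A I J \<longleftrightarrow>
      (\<forall>c\<in>C. \<forall>i \<in> annihilator A I. \<forall>j \<in> annihilator A J. c \<otimes> i \<otimes> j = \<zero>)"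
    using Cc ann mem_J
    by (auto simp: coproduct_def ideal_quotient_def subset_iff)
  also have "\<dots> \<longleftrightarrow>
      (\<forall>c\<in>C. \<forall>i \<in> annihilator A I. \<forall>j \<in> annihilator A J. i \<otimes> j \<otimes> c = \<zero>)"
    using Cc ann by (intro ball_cong refl) (simp add: m_ac)
  also have "\<dots> \<longleftrightarrow>
      (\<forall>i \<in> annihilator A I. \<forall>j \<in> annihilator A J. i \<otimes> j \<in> annihilator A C)"
    using ann by (auto simp: annihilator_def[of A C])
  finally show ?thesis .
qed

text \<open>Primality is a condition on elements \<open>a\<close> and \<open>b\<close>; it follows
  from coprimality tested on the annihilators of the principal ideals they generate.\<close>

lemma primeideal_annihilator:
  assumes "coprime_ideal A C"
  shows "primeideal (annihilator A C) A"
proof -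
  have C: "ideal C A" and nz: "C \<noteq> {\<zero>}"
    and cop: "\<And>I J. ideal I A \<Longrightarrow> ideal J A \<Longrightarrow> C \<subseteq> coproduct A I J \<Longrightarrow> C \<subseteq> I \<or> C \<subseteq> J"
    using assms by (auto simp: coprime_ideal_def)
  interpret annC: ideal "annihilator A C" A
    by (intro ideal_annihilator ideal.Icarr[OF C] subsetI)
  show ?thesis
  proof (rule primeidealI)
    show "ideal (annihilator A C) A" by (rule annC.ideal_axioms)
    show "cring A" by (rule is_cring)
    show "carrier A \<noteq> annihilator A C"
      using one_in_annihilator_iff[OF C] nz by auto
  next
    fix a b assume a: "a \<in> carrier A" and b: "b \<in> carrier A"
      and ab: "a \<otimes> b \<in> annihilator A C"
    have ideal_ann: "ideal (annihilator A (PIdl x)) A" if "x \<in> carrier A" for x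
      using that by (intro ideal_annihilator) (auto simp: cgenideal_def)
    have double: "annihilator A (annihilator A (PIdl x)) = PIdl x" if "x \<in> carrier A" for x
      using that by (intro annihilator_annihilator cgenideal_ideal)
    \<comment> \<open>These are the products of an element of \<open>PIdl a\<close> with one of
      \<open>PIdl b\<close>.\<close>
    have "x \<otimes> a \<otimes> (y \<otimes> b) \<in> annihilator A C" if "x \<in> carrier A" "y \<in> carrier A" for x y
    proof -
      have "x \<otimes> a \<otimes> (y \<otimes> b) = (x \<otimes> y) \<otimes> (a \<otimes> b)"
        using a b that by (simp add: m_ac)
      then show ?thesis
        using annC.I_l_closed[OF ab] that by simp
    qed
    then have "C \<subseteq> coproduct A (annihilator A (PIdl a)) (annihilator A (PIdl b))"
      unfolding subset_coproduct_iff[OF C ideal_ann[OF b]] double[OF a] double[OF b]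
      by (auto simp: cgenideal_def)
    then have "C \<subseteq> annihilator A (PIdl a) \<or> C \<subseteq> annihilator A (PIdl b)"
      by (intro cop ideal_ann a b)
    \<comment> \<open>Annihilating both sides of each inclusion turns the right-hand side back into
      a principal ideal by \<open>double\<close>.\<close>
    then have "PIdl a \<subseteq> annihilator A C \<or> PIdl b \<subseteq> annihilator A C"
      using annihilator_antimono[of C _ A] double a b by metis
    then show "a \<in> annihilator A C \<or> b \<in> annihilator A C"
      using cgenideal_self a b by blast
  qed
qed

lemma coprime_ideal_annihilator:
  assumes "primeideal P A"
  shows "coprime_ideal A (annihilator A P)"
  unfolding coprime_ideal_def
proof (intro conjI allI impI)
  interpret P: primeideal P A by fact
  have PP: "annihilator A (annihilator A P) = P"
    by (rule annihilator_annihilator[OF P.ideal_axioms])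
  show annP: "ideal (annihilator A P) A"
    by (intro ideal_annihilator P.Icarr subsetI)
  \<comment> \<open>Otherwise \<open>\<one>\<close> would lie in the double annihilator, which is
    the proper ideal \<open>P\<close>.\<close>
  show "annihilator A P \<noteq> {\<zero>}"
    using one_in_annihilator_iff[OF annP] P.one_imp_carrier P.I_notcarr PP by auto
  fix I J assume I: "ideal I A" and J: "ideal J A"
    and sub: "annihilator A P \<subseteq> coproduct A I J"
  have "i \<in> P \<or> j \<in> P" if "i \<in> annihilator A I" "j \<in> annihilator A J" for i j
    using that sub P.I_prime unfolding subset_coproduct_iff[OF annP J] PP
    by (auto simp: annihilator_def)
  \<comment> \<open>If some \<open>i\<close> lies outside \<open>P\<close>, pairing it with each
    \<open>j\<close> forces all of \<open>annihilator A J\<close> into \<open>P\<close>.\<close>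
  then have "annihilator A I \<subseteq> P \<or> annihilator A J \<subseteq> P"
    by blast
  then show "annihilator A P \<subseteq> I \<or> annihilator A P \<subseteq> J"
    using subset_iff_annihilator[OF annP I] subset_iff_annihilator[OF annP J] PP by simp
qed

end

theorem corollary5:
  fixes A :: "('a, 'b) ring_scheme"
  assumes "dual_ring A"
  shows "bij_betw (annihilator A) (CoSp A) (Spec A) \<and>
         bij_betw (annihilator A) (Spec A) (CoSp A) \<and>
         (\<forall>C \<in> CoSp A. annihilator A (annihilator A C) = C) \<and>
         (\<forall>P \<in> Spec A. annihilator A (annihilator A P) = P)"
proof -
  interpret dual_ring A by fact
  have CC: "\<forall>C \<in> CoSp A. annihilator A (annihilator A C) = C"
    by (auto simp: CoSp_def coprime_ideal_def annihilator_annihilator)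
  have PP: "\<forall>P \<in> Spec A. annihilator A (annihilator A P) = P"
    by (auto simp: Spec_def annihilator_annihilator primeideal.axioms)
  have "annihilator A ` CoSp A \<subseteq> Spec A" "annihilator A ` Spec A \<subseteq> CoSp A"
    by (auto simp: CoSp_def Spec_def primeideal_annihilator coprime_ideal_annihilator)
  \<comment> \<open>In both directions the witness for the inverse is \<open>annihilator A\<close>
    itself.\<close>
  then show ?thesis
    using CC PP bij_betw_byWitness[of "CoSp A" "annihilator A" "annihilator A" "Spec A"]
      bij_betw_byWitness[of "Spec A" "annihilator A" "annihilator A" "CoSp A"]
    by blast
qed

end
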